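(* $$4\sum_{\substack{a,b,c,d\in\mathbb{Z}_{\ge 0}\\ ad-bc=1}} \left(a\arctan\left(\frac{a}{b}\right)+c\arctan\left(\frac{c}{d}\right)-(a+c)\arctan\left(\frac{a+c}{b+d}\right)\right)^2=\pi ,$$ where the sum runs over all quadruples $(a,b,c,d)$ of non-negative integers with $ad-bc=1$.
   Context: When $b=0$ (which forces $a=d=1$), $\arctan(a/b)$ is understood as $\pi/2$; that is, $\arctan(a/b)\in[0,\pi/2]$ is the angle between the vector $(a,b)$ and the positive $y$-axis. *)

theory Defs
  imports "HOL-Analysis.Analysis"
begin

text \<open>
  The angle in \<open>[0, \<pi>/2]\<close> between the vector \<open>(a, b)\<close> and the positive \<open>y\<close>-axis. The case
  \<open>b = 0\<close> must be separated, since \<open>arctan (a / 0) = arctan 0 = 0\<close> in HOL; the value at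
  \<open>a = b = 0\<close> is irrelevant.
\<close>

definition arctan_ratio :: "nat \<Rightarrow> nat \<Rightarrow> real" where
  "arctan_ratio a b = (if b = 0 then pi / 2 else arctan (real a / real b))"

end

theory Submission
  imports Defs
begin

text \<open>
  Put \<open>\<theta>(a,b) = arctan (a / b)\<close> and \<open>F(u) = a \<theta>(u)\<close> for \<open>u = (a,b)\<close>. This is the support function
  of a cycloid arc, and \<open>(F(u) + F(v) - F(u + v))\<^sup>2\<close> is twice the area of the triangle which the
  tangent line with normal \<open>u + v\<close> cuts off from the corner formed by the tangent lines with normals
  \<open>u\<close> and \<open>v\<close>. Descending the Stern--Brocot tree of pairs \<open>(u,v)\<close> with determinant \<open>1\<close>, the
  triangles exhaust the region between the corner at the root and the arc, whose doubled area is
  \<open>\<pi>/4\<close>. The doubled area still to be cut off at \<open>(u,v)\<close> is \<open>corner_area\<close>; it is at most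
  \<open>(\<theta>(u) - \<theta>(v)) / (u \<bullet> v)\<close> in absolute value, where \<open>u \<bullet> v\<close> is at least the depth and the
  angles \<open>\<theta>(u) - \<theta>(v)\<close> on each level add up to \<open>\<pi>/2\<close>.
\<close>

section \<open>The Stern-Brocot tree of pairs with determinant 1\<close>

type_synonym quad = "nat \<times> nat \<times> nat \<times> nat"

definition unimodular :: "quad set" where
  "unimodular = {(a, b, c, d). int a * int d - int b * int c = 1}"

fun left_child :: "quad \<Rightarrow> quad" where
  "left_child (a, b, c, d) = (a, b, a + c, b + d)"

fun right_child :: "quad \<Rightarrow> quad" where
  "right_child (a, b, c, d) = (a + c, b + d, c, d)"

text \<open>The head of the list is the last step of the descent, so consing passes from a node to
  one of its children.\<close>

fun node :: "bool list \<Rightarrow> quad" where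
  "node [] = (1, 0, 0, 1)"
| "node (x # xs) = (if x then left_child else right_child) (node xs)"

lemma unimodular_iff: "(a, b, c, d) \<in> unimodular \<longleftrightarrow> a * d = b * c + 1"
proof -
  have "(a, b, c, d) \<in> unimodular \<longleftrightarrow> int (a * d) = int (b * c + 1)"
    by (auto simp: unimodular_def)
  then show ?thesis
    by (simp only: of_nat_eq_iff)
qed

lemma left_child_unimodular: "m \<in> unimodular \<Longrightarrow> left_child m \<in> unimodular"
  by (cases m) (auto simp: unimodular_iff algebra_simps)

lemma right_child_unimodular: "m \<in> unimodular \<Longrightarrow> right_child m \<in> unimodular"
  by (cases m) (auto simp: unimodular_iff algebra_simps)

lemma node_unimodular: "node xs \<in> unimodular"
  by (induction xs) (auto simp: left_child_unimodular right_child_unimodular, simp add: unimodular_iff)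

lemma inj_left_child: "inj left_child"
  by (rule injI) auto

lemma inj_right_child: "inj right_child"
  by (rule injI) auto

text \<open>Equality gives \<open>a = a' + c'\<close> and \<open>c' = a + c\<close>, hence
  \<open>c = 0\<close>; likewise \<open>d = 0\<close>, and the determinant of \<open>m\<close> would
  vanish.\<close>

lemma left_child_neq_right_child:
  assumes "m \<in> unimodular" "m' \<in> unimodular"
  shows "left_child m \<noteq> right_child m'"
proof (cases m; cases m')
  fix a b c d a' b' c' d'
  assume m: "m = (a, b, c, d)" "m' = (a', b', c', d')"
  show ?thesis
  proof
    assume "left_child m = right_child m'"
    then have "c = 0" "d = 0"
      using m by auto
    then show False
      using assms m by (simp add: unimodular_iff)
  qed
qed

lemma left_child_neq_root: "m \<in> unimodular \<Longrightarrow> left_child m \<noteq> node []"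
  by (cases m) (auto simp: unimodular_iff)

lemma right_child_neq_root: "m \<in> unimodular \<Longrightarrow> right_child m \<noteq> node []"
  by (cases m) (auto simp: unimodular_iff)

lemma node_Cons_neq_root: "node (x # xs) \<noteq> node []"
  using left_child_neq_root[OF node_unimodular] right_child_neq_root[OF node_unimodular]
  by (cases x) (simp_all del: node.simps(1))

lemma node_Cons_eq_iff: "node (x # xs) = node (y # ys) \<longleftrightarrow> x = y \<and> node xs = node ys"
  using left_child_neq_right_child[OF node_unimodular node_unimodular, of xs ys]
    left_child_neq_right_child[OF node_unimodular node_unimodular, of ys xs]
  by (cases x; cases y)
    (simp_all add: inj_eq[OF inj_left_child] inj_eq[OF inj_right_child] eq_commute)

lemma inj_node: "inj node"
proof (rule injI)
  fix xs ys
  show "node xs = node ys \<Longrightarrow> xs = ys"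
  proof (induction xs arbitrary: ys)
    case Nil
    then show ?case
      using node_Cons_neq_root by (metis list.exhaust)
  next
    case (Cons x xs)
    then obtain y ys' where ys: "ys = y # ys'"
      using node_Cons_neq_root by (metis list.exhaust)
    with Cons show ?case
      by (simp only: node_Cons_eq_iff)
  qed
qed

text \<open>Determinant 1 makes the two vectors comparable coordinatewise except at the root:
  \<open>a < c\<close> and \<open>d < b\<close> would make \<open>a * d\<close> too small, while
  \<open>c < a\<close> and \<open>b < d\<close> give \<open>a * d\<close> at least
  \<open>(c + 1) * (b + 1)\<close>, which forces \<open>b = c = 0\<close>.\<close>

lemma unimodular_cases:
  assumes "(a, b, c, d) \<in> unimodular"
  obtains (root) "(a, b, c, d) = node []"
    | (left) "a \<le> c" "b \<le> d"
    | (right) "c \<le> a" "d \<le> b"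
proof -
  have eq: "a * d = b * c + 1"
    using assms by (simp add: unimodular_iff)
  consider "a \<le> c \<and> b \<le> d" | "c \<le> a \<and> d \<le> b" | "a < c \<and> d < b" | "c < a \<and> b < d"
    by linarith
  then show thesis
  proof cases
    case 3
    then have "a * d \<le> c * b"
      by (intro mult_le_mono) auto
    with eq show ?thesis
      by (simp add: mult.commute)
  next
    case 4
    then have "(c + 1) * (b + 1) \<le> a * d"
      by (intro mult_le_mono) auto
    with eq have "b = 0" "c = 0"
      by (auto simp: algebra_simps)
    with eq have "(a, b, c, d) = node []"
      by simp
    then show ?thesis
      by (rule root)
  qed (auto intro: left right)
qed

text \<open>Subtractive Euclidean algorithm: taking the smaller vector from the larger one undoes a
  step of the descent.\<close>

lemma unimodular_imp_node: "m \<in> unimodular \<Longrightarrow> m \<in> range node"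
proof (induction "case m of (a, b, c, d) \<Rightarrow> a + b + c + d" arbitrary: m rule: less_induct)
  case less
  obtain a b c d where m: "m = (a, b, c, d)"
    by (cases m)
  have eq: "a * d = b * c + 1"
    using less.prems m by (simp add: unimodular_iff)
  \<comment> \<open>Hence the subtracted vector is nonzero in either case, and the coordinate sum
    drops.\<close>
  then have pos: "a > 0" "d > 0"
    by (auto intro: Nat.gr0I)
  have "(a, b, c, d) \<in> unimodular"
    using less.prems m by simp
  then show ?case
  proof (cases rule: unimodular_cases)
    case root
    then show ?thesis
      using m by blast
  next
    case left
    have "(a, b, c - a, d - b) \<in> unimodular"
      using eq mult_le_mono2[OF left(1), of b]
      by (simp add: unimodular_iff diff_mult_distrib2 mult.commute Suc_diff_le)
    then have "(a, b, c - a, d - b) \<in> range node"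
      using less.hyps[of "(a, b, c - a, d - b)"] left pos m by simp
    then obtain xs where "node xs = (a, b, c - a, d - b)"
      by auto
    then have "node (True # xs) = m"
      using left m by simp
    then show ?thesis
      by blast
  next
    case right
    have "(a - c, b - d, c, d) \<in> unimodular"
    proof -
      have "c * d \<le> c * b"
        using right(2) by (rule mult_le_mono2)
      then have "a * d - c * d = (b * c - d * c) + 1"
        using eq by (simp add: mult.commute Suc_diff_le del: mult_le_cancel1 nat_mult_le_cancel_disj)
      then show ?thesis
        by (simp only: unimodular_iff diff_mult_distrib)
    qed
    then have "(a - c, b - d, c, d) \<in> range node"
      using less.hyps[of "(a - c, b - d, c, d)"] right pos m by simp
    then obtain xs where "node xs = (a - c, b - d, c, d)"
      by auto
    then have "node (False # xs) = m"
      using right m by simp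
    then show ?thesis
      by blast
  qed
qed

lemma bij_betw_node: "bij_betw node UNIV unimodular"
  using inj_node node_unimodular unimodular_imp_node by (auto simp: bij_betw_def)

section \<open>Summation over binary words by length\<close>

lemma finite_bool_lists: "finite {xs :: bool list. length xs = n}"
  using finite_lists_length_eq[of "UNIV :: bool set" n] by simp

lemma sum_bool_lists_Suc:
  fixes f :: "bool list \<Rightarrow> real"
  shows "(\<Sum>xs | length xs = Suc n. f xs) = (\<Sum>xs | length xs = n. f (True # xs) + f (False # xs))"
proof -
  have *: "{xs :: bool list. length xs = Suc n} =
      (#) True ` {xs. length xs = n} \<union> (#) False ` {xs. length xs = n}"
    by (auto simp: length_Suc_conv image_iff)
  show ?thesis
    unfolding * by (subst sum.union_disjoint)
      (auto simp: finite_bool_lists sum.reindex sum.distrib)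
qed

text \<open>For non-negative terms one exhaustion by finite sets decides the unordered sum: every
  finite set lies in some \<open>B n\<close>, so its sum is at most \<open>s\<close>.\<close>

lemma has_sum_bool_listsI:
  fixes f :: "bool list \<Rightarrow> real"
  assumes nonneg: "\<And>xs. f xs \<ge> 0"
    and lim: "(\<lambda>n. \<Sum>k<n. \<Sum>xs | length xs = k. f xs) \<longlonglongrightarrow> s"
  shows "(f has_sum s) UNIV"
proof -
  define B where "B n = {xs :: bool list. length xs < n}" for n
  have fin: "finite (B n)" for n
    using finite_lists_length_le[of "UNIV :: bool set" n]
    by (rule rev_finite_subset) (auto simp: B_def)
  have BSuc: "B (Suc n) = B n \<union> {xs. length xs = n}" for n
    by (auto simp: B_def)
  have "sum f (B n) = (\<Sum>k<n. \<Sum>xs | length xs = k. f xs)" for n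
  proof (induction n)
    case (Suc n)
    have "sum f (B (Suc n)) = sum f (B n) + (\<Sum>xs | length xs = n. f xs)"
      unfolding BSuc using fin finite_bool_lists
      by (intro sum.union_disjoint) (auto simp: B_def)
    with Suc show ?case
      by simp
  qed (simp add: B_def)
  with lim have limB: "(\<lambda>n. sum f (B n)) \<longlonglongrightarrow> s"
    by simp
  have mono: "incseq (\<lambda>n. sum f (B n))"
    by (intro incseq_SucI sum_mono2) (auto simp: fin BSuc finite_bool_lists nonneg)
  have upper: "sum f X \<le> s" if "finite X" for X
  proof -
    \<comment> \<open>For empty \<open>X\<close> the \<open>Max\<close> is unspecified, but the
      inclusion is trivial.\<close>
    have "X \<subseteq> B (Suc (Max (length ` X)))"
      using that by (auto simp: B_def less_Suc_eq_le)
    then have "sum f X \<le> sum f (B (Suc (Max (length ` X))))"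
      by (intro sum_mono2) (auto simp: fin nonneg)
    also have "\<dots> \<le> s"
      by (rule incseq_le[OF mono limB])
    finally show ?thesis .
  qed
  show ?thesis
    unfolding has_sum_def
  proof (rule order_tendstoI)
    fix y assume "y < s"
    then obtain n where n: "y < sum f (B n)"
      using order_tendstoD(1)[OF limB] by (auto simp: eventually_sequentially)
    show "\<forall>\<^sub>F X in finite_subsets_at_top UNIV. y < sum f X"
      unfolding eventually_finite_subsets_at_top
    proof (intro exI[of _ "B n"] conjI allI impI)
      fix Y assume Y: "finite Y \<and> B n \<subseteq> Y \<and> Y \<subseteq> UNIV"
      then have "sum f (B n) \<le> sum f Y"
        by (intro sum_mono2) (auto simp: nonneg)
      with n show "y < sum f Y"
        by simp
    qed (auto simp: fin)
  next
    fix y assume y: "s < y"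
    show "\<forall>\<^sub>F X in finite_subsets_at_top UNIV. sum f X < y"
      by (rule eventually_finite_subsets_at_top_weakI) (use upper y in fastforce)
  qed
qed

section \<open>Angles, defects and remaining areas under splitting\<close>

fun angle :: "quad \<Rightarrow> real" where
  "angle (a, b, c, d) = arctan_ratio a b - arctan_ratio c d"

fun dot :: "quad \<Rightarrow> nat" where
  "dot (a, b, c, d) = a * c + b * d"

fun defect :: "quad \<Rightarrow> real" where
  "defect (a, b, c, d) = real a * arctan_ratio a b + real c * arctan_ratio c d
     - real (a + c) * arctan_ratio (a + c) (b + d)"

text \<open>For nonzero vectors the quotients are values of sin * cos at the two angles, so
  everything except the squared term is the integral of sin^2 between these angles.\<close>

fun corner_area :: "quad \<Rightarrow> real" where
  "corner_area (a, b, c, d) =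
     (arctan_ratio a b - arctan_ratio c d) / 2
     - real a * real c * (arctan_ratio a b - arctan_ratio c d)\<^sup>2
     - (real a * real b / ((real a)\<^sup>2 + (real b)\<^sup>2) - real c * real d / ((real c)\<^sup>2 + (real d)\<^sup>2)) / 2"

lemma angle_split: "angle (left_child m) + angle (right_child m) = angle m"
  by (cases m) auto

text \<open>The terms without a square telescope. For the others, write the defect as
  \<open>a * (x - z) + c * (y - z)\<close>; in \<open>key\<close> the products of
  \<open>x - z\<close> and \<open>y - z\<close> cancel.\<close>

lemma corner_area_split:
  "corner_area (left_child m) + corner_area (right_child m) = corner_area m - (defect m)\<^sup>2"
proof (cases m)
  case (fields a b c d)
  define x y z where "x = arctan_ratio a b" "y = arctan_ratio c d" "z = arctan_ratio (a + c) (b + d)"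
  have key: "real a * real c * (x - y)\<^sup>2 + (real a * x + real c * y - real (a + c) * z)\<^sup>2
      = real a * real (a + c) * (x - z)\<^sup>2 + real (a + c) * real c * (z - y)\<^sup>2"
    by (simp add: algebra_simps power2_eq_square)
  show ?thesis
    using key unfolding fields left_child.simps right_child.simps corner_area.simps defect.simps
      x_y_z_def by (simp add: diff_divide_distrib add_divide_distrib)
qed

text \<open>Each step adds the squared length of the vector that is kept, which is at least
  1.\<close>

lemma length_le_dot_node: "length xs \<le> dot (node xs)"
proof (induction xs)
  case (Cons x xs)
  obtain a b c d where m: "node xs = (a, b, c, d)"
    by (cases "node xs")
  have "a * d = b * c + 1"
    using node_unimodular[of xs] m by (simp add: unimodular_iff)
  then have "a > 0" "d > 0"
    by (auto intro: Nat.gr0I)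
  then have "a * a > 0" "d * d > 0"
    by auto
  then show ?case
    using Cons.IH m by (cases x) (auto simp: algebra_simps simp del: mult_pos_pos nat_0_less_mult_iff)
qed simp

text \<open>The tangent of the angle between two vectors is determinant over inner product, and the
  determinant is 1. At the root the inner product is 0 and the angle is
  \<open>pi / 2\<close>.\<close>

lemma angle_eq_arctan:
  assumes "m \<in> unimodular" "dot m > 0"
  shows "angle m = arctan (1 / real (dot m))"
proof (cases m)
  case (fields a b c d)
  have eq: "a * d = b * c + 1"
    using assms(1) fields by (simp add: unimodular_iff)
  then have pos: "a > 0" "d > 0"
    by (auto intro: Nat.gr0I)
  have eqr: "real a * real d = real b * real c + 1"
    using eq by (metis of_nat_1 of_nat_add of_nat_mult)
  show ?thesis
  \<comment> \<open>For \<open>b = 0\<close> the first angle is \<open>pi / 2\<close> by convention,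
    and the reflection formula for arctan replaces the tangent computation.\<close>
  proof (cases "b = 0")
    case True
    then have "a = 1" "d = 1"
      using eq by auto
    moreover from this have "c > 0"
      using assms(2) fields True by simp
    ultimately show ?thesis
      using fields True arctan_inverse[of "real c"]
      by (simp add: arctan_ratio_def sgn_if inverse_eq_divide)
  next
    case False
    define s t where "s = arctan (real c / real d)" "t = arctan (real a / real b)"
    have st: "angle m = t - s"
      using fields False pos by (simp add: arctan_ratio_def s_t_def)
    have "real c / real d \<le> real a / real b"
      using eqr False pos by (simp add: field_simps)
    then have "s \<le> t"
      unfolding s_t_def by (rule arctan_monotone')
    moreover have "s \<ge> 0"
      by (simp add: s_t_def)
    moreover have "t < pi / 2"
      unfolding s_t_def by (rule arctan_ubound)
    ultimately have range: "- (pi / 2) < t - s" "t - s < pi / 2"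
      using pi_gt_zero by linarith+
    have cos: "cos s \<noteq> 0" "cos t \<noteq> 0" "cos (t - s) \<noteq> 0"
      using range cos_gt_zero_pi[of "t - s"] by (auto simp: s_t_def)
    have "tan (t - s) = (real a / real b - real c / real d) / (1 + real a / real b * (real c / real d))"
      using tan_diff[OF cos(2,1,3)] by (simp add: s_t_def tan_arctan)
    also have "\<dots> = (real a * real d - real b * real c) / (real b * real d + real a * real c)"
      using False pos by (simp add: divide_simps add_pos_nonneg add_nonneg_eq_0_iff)
    also have "\<dots> = 1 / real (dot m)"
      using eqr fields by (simp add: add.commute)
    finally show ?thesis
      using arctan_unique[OF range] st by simp
  qed
qed

section \<open>Bounding the remaining area\<close>

lemma arctan_ge_div_sqrt:
  assumes "x \<ge> 0"
  shows "x / sqrt (1 + x\<^sup>2) \<le> arctan x"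
  using sin_x_le_x[of "arctan x"] assms by (simp add: sin_arctan)

text \<open>The area is a difference of two non-negative quantities, controlled by \<open>e\<close>
  lying between \<open>1 / sqrt (1 + D\<^sup>2)\<close> and \<open>1 / D\<close>. Neither exceeds
  \<open>1 / (1 + D\<^sup>2) / D\<close>, which is at most \<open>e / D\<close>.\<close>

lemma abs_corner_area_le:
  assumes "m \<in> unimodular" "dot m > 0"
  shows "\<bar>corner_area m\<bar> \<le> angle m / real (dot m)"
proof (cases m)
  case (fields a b c d)
  define D where "D = real (dot m)"
  define e where "e = angle m"
  define p where "p = real a * real c"
  have D: "D \<ge> 1"
    using assms(2) by (simp add: D_def)
  have eq: "a * d = b * c + 1"
    using assms(1) fields by (simp add: unimodular_iff)
  then have pos: "a > 0" "d > 0"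
    by (auto intro: Nat.gr0I)
  have eqr: "real a * real d = real b * real c + 1"
    using eq by (metis of_nat_1 of_nat_add of_nat_mult)
  have D_eq: "D = p + real b * real d"
    by (simp add: D_def p_def fields)
  have p: "0 \<le> p" "p \<le> D"
    by (auto simp: D_eq p_def)
  have e_eq: "e = arctan (1 / D)"
    using angle_eq_arctan[OF assms] by (simp add: e_def D_def)
  have e_le: "e \<le> 1 / D"
    using D arctan_le_self[of "1 / D"] by (simp add: e_eq)
  have "1 / sqrt (1 + D\<^sup>2) = (1 / D) / sqrt (1 + (1 / D)\<^sup>2)"
  proof -
    have "D * sqrt (1 + (1 / D)\<^sup>2) = sqrt (D\<^sup>2 * (1 + (1 / D)\<^sup>2))"
      using D by (simp add: real_sqrt_mult)
    also have "D\<^sup>2 * (1 + (1 / D)\<^sup>2) = 1 + D\<^sup>2"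
      using D by (simp add: field_simps)
    finally show ?thesis
      by simp
  qed
  also have "\<dots> \<le> e"
    using D arctan_ge_div_sqrt[of "1 / D"] by (simp add: e_eq)
  finally have e_ge: "1 / sqrt (1 + D\<^sup>2) \<le> e" .
  have D2: "1 + D\<^sup>2 > 0"
    by (simp add: add_pos_nonneg)
  have e0: "e \<ge> 0"
    using e_ge by (meson D2 order_trans less_imp_le real_sqrt_ge_zero zero_le_divide_1_iff)
  have "(1 / sqrt (1 + D\<^sup>2))\<^sup>2 \<le> e\<^sup>2"
    using e_ge D2 by (intro power_mono) auto
  then have e2_ge: "1 / (1 + D\<^sup>2) \<le> e\<^sup>2"
    using D2 by (simp add: power_divide)
  have e2_le: "e\<^sup>2 \<le> 1 / D\<^sup>2"
    using power_mono[OF e_le e0, of 2] by (simp add: power_divide)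
  have e_ge_D: "D / (1 + D\<^sup>2) \<le> e"
  proof -
    have "D \<le> sqrt (1 + D\<^sup>2)"
      by (rule real_le_rsqrt) simp
    then have "D / (1 + D\<^sup>2) \<le> sqrt (1 + D\<^sup>2) / (1 + D\<^sup>2)"
      using D2 by (intro divide_right_mono) auto
    also have "\<dots> = 1 / sqrt (1 + D\<^sup>2)"
      using D2 by (simp add: field_simps)
    finally show ?thesis
      using e_ge by linarith
  qed
  have gap: "1 / D - D / (1 + D\<^sup>2) = 1 / (1 + D\<^sup>2) / D"
    using D D2 by (simp add: field_simps power2_eq_square)
  have "1 / (1 + D\<^sup>2) \<le> 1 / sqrt (1 + D\<^sup>2)"
    by (intro divide_left_mono) (auto simp: add_pos_nonneg intro!: real_le_lsqrt self_le_power)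
  then have bound: "1 / (1 + D\<^sup>2) / D \<le> e / D"
    using e_ge D by (intro divide_right_mono) auto
  \<comment> \<open>Lagrange's identity with determinant 1.\<close>
  have prod: "((real a)\<^sup>2 + (real b)\<^sup>2) * ((real c)\<^sup>2 + (real d)\<^sup>2) = 1 + D\<^sup>2"
  proof -
    have "((real a)\<^sup>2 + (real b)\<^sup>2) * ((real c)\<^sup>2 + (real d)\<^sup>2) = (real a * real d - real b * real c)\<^sup>2 + D\<^sup>2"
      by (simp add: D_eq p_def algebra_simps power2_eq_square)
    then show ?thesis
      using eqr by simp
  qed
  have "real a * real b / ((real a)\<^sup>2 + (real b)\<^sup>2) - real c * real d / ((real c)\<^sup>2 + (real d)\<^sup>2)
      = (real a * real b * ((real c)\<^sup>2 + (real d)\<^sup>2) - real c * real d * ((real a)\<^sup>2 + (real b)\<^sup>2)) / (1 + D\<^sup>2)"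
    using pos by (subst diff_frac_eq) (auto simp: prod sum_power2_eq_zero_iff)
  \<comment> \<open>The numerator contains the determinant as a factor, which leaves
    \<open>D - 2 * p\<close>.\<close>
  also have "real a * real b * ((real c)\<^sup>2 + (real d)\<^sup>2) - real c * real d * ((real a)\<^sup>2 + (real b)\<^sup>2)
      = (real b * real d - real a * real c) * (real a * real d - real b * real c)"
    by (simp add: algebra_simps power2_eq_square)
  also have "\<dots> = D - 2 * p"
    using eqr by (simp add: D_eq p_def)
  finally have "corner_area m = e / 2 - p * e\<^sup>2 - (D - 2 * p) / (1 + D\<^sup>2) / 2"
    by (simp add: fields e_def p_def)
  also have "\<dots> = (e - D / (1 + D\<^sup>2)) / 2 - p * (e\<^sup>2 - 1 / (1 + D\<^sup>2))"
  proof -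
    have "(D - 2 * p) / (1 + D\<^sup>2) / 2 = D / (1 + D\<^sup>2) / 2 - p * (1 / (1 + D\<^sup>2))"
      by (simp only: diff_divide_distrib divide_divide_eq_left mult.commute[of _ 2])
        (subst mult_divide_mult_cancel_left, simp_all)
    then show ?thesis
      by (simp only: diff_divide_distrib right_diff_distrib)
  qed
  finally have area: "corner_area m = (e - D / (1 + D\<^sup>2)) / 2 - p * (e\<^sup>2 - 1 / (1 + D\<^sup>2))" .
  have q_ge: "0 \<le> p * (e\<^sup>2 - 1 / (1 + D\<^sup>2))"
    using p e2_ge by simp
  have "p * (e\<^sup>2 - 1 / (1 + D\<^sup>2)) \<le> D * (1 / D\<^sup>2 - 1 / (1 + D\<^sup>2))"
    using p e2_ge e2_le by (intro mult_mono) auto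
  also have "\<dots> = 1 / (1 + D\<^sup>2) / D"
    using D gap by (simp add: right_diff_distrib power2_eq_square)
  finally have q_le: "p * (e\<^sup>2 - 1 / (1 + D\<^sup>2)) \<le> 1 / (1 + D\<^sup>2) / D" .
  \<comment> \<open>Here \<open>k\<close> and \<open>h\<close> enclose \<open>e\<close> at distance
    \<open>g\<close>, so the first part of \<open>A\<close> lies between 0 and \<open>g / 2\<close>,
    and \<open>q\<close> between 0 and \<open>g\<close>.\<close>
  have "\<bar>A\<bar> \<le> g" if "A = (e - k) / 2 - q" "0 \<le> q" "q \<le> g" "e \<le> h" "k \<le> e" "h - k = g"
    for A g h k q :: real
    unfolding abs_le_iff using that by (auto simp: field_simps)
  from this[OF area q_ge q_le e_le e_ge_D gap]
  have "\<bar>corner_area m\<bar> \<le> 1 / (1 + D\<^sup>2) / D" .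
  with bound show ?thesis
    by (simp add: e_def D_def)
qed

section \<open>Level sums and the limit\<close>

lemma sum_angle_level: "(\<Sum>xs | length xs = n. angle (node xs)) = pi / 2"
proof (induction n)
  case 0
  then show ?case
    by (simp add: arctan_ratio_def)
next
  case (Suc n)
  then show ?case
    by (simp add: sum_bool_lists_Suc angle_split)
qed

text \<open>Each level loses exactly its squared defects when split; \<open>pi / 4\<close> is the
  value at the root.\<close>

lemma sum_corner_area_level:
  "(\<Sum>xs | length xs = n. corner_area (node xs))
     = pi / 4 - (\<Sum>k<n. \<Sum>xs | length xs = k. (defect (node xs))\<^sup>2)"
proof (induction n)
  case 0
  then show ?case
    by (simp add: arctan_ratio_def)
next
  case (Suc n)
  then show ?case
    by (simp add: sum_bool_lists_Suc corner_area_split sum_subtractf)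
qed

lemma corner_area_level_tendsto_0: "(\<lambda>n. \<Sum>xs | length xs = n. corner_area (node xs)) \<longlonglongrightarrow> 0"
proof (rule Lim_null_comparison)
  \<comment> \<open>On level \<open>n\<close> inner products are at least \<open>n\<close> and the
    angles total \<open>pi / 2\<close>; \<open>n > 0\<close> leaves out the root, whose inner
    product is 0.\<close>
  have "norm (\<Sum>xs | length xs = n. corner_area (node xs)) \<le> pi / 2 / real n" if "n > 0" for n
  proof -
    have "\<bar>corner_area (node xs)\<bar> \<le> angle (node xs) / real n" if "length xs = n" for xs
    proof -
      have le: "n \<le> dot (node xs)"
        using length_le_dot_node[of xs] that by simp
      then have pos: "dot (node xs) > 0"
        using \<open>n > 0\<close> by linarith
      have "angle (node xs) \<ge> 0"
        using angle_eq_arctan[OF node_unimodular pos] by simp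
      then have "angle (node xs) / real (dot (node xs)) \<le> angle (node xs) / real n"
        using le pos \<open>n > 0\<close> by (intro divide_left_mono) auto
      then show ?thesis
        using abs_corner_area_le[OF node_unimodular pos] by linarith
    qed
    then have "norm (\<Sum>xs | length xs = n. corner_area (node xs))
        \<le> (\<Sum>xs | length xs = n. angle (node xs) / real n)"
      by (intro sum_norm_le) auto
    also have "\<dots> = pi / 2 / real n"
      by (simp flip: sum_divide_distrib add: sum_angle_level)
    finally show ?thesis .
  qed
  then show "\<forall>\<^sub>F n in sequentially. norm (\<Sum>xs | length xs = n. corner_area (node xs)) \<le> pi / 2 / real n"
    using eventually_gt_at_top[of 0] by (rule eventually_mono[rotated])
  show "(\<lambda>n. pi / 2 / real n) \<longlonglongrightarrow> 0"
    by (rule lim_const_over_n)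
qed

lemma has_sum_defect_squared: "((\<lambda>m. (defect m)\<^sup>2) has_sum (pi / 4)) unimodular"
proof -
  \<comment> \<open>By telescoping, these are the partial sums of the squared defects over the
    levels below \<open>n\<close>.\<close>
  have "(\<lambda>n. pi / 4 - (\<Sum>xs | length xs = n. corner_area (node xs))) \<longlonglongrightarrow> pi / 4 - 0"
    by (intro tendsto_diff tendsto_const corner_area_level_tendsto_0)
  then have "((\<lambda>xs. (defect (node xs))\<^sup>2) has_sum (pi / 4)) UNIV"
    by (intro has_sum_bool_listsI) (simp_all add: sum_corner_area_level)
  then show ?thesis
    using has_sum_reindex_bij_betw[OF bij_betw_node] by blast
qed

theorem mainTheorem1:
  shows "4 * (\<Sum>\<^sub>\<infinity>(a, b, c, d) \<in> {(a :: nat, b :: nat, c :: nat, d :: nat).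
                 int a * int d - int b * int c = 1}.
              (real a * arctan_ratio a b + real c * arctan_ratio c d
                - real (a + c) * arctan_ratio (a + c) (b + d))\<^sup>2) = pi"
proof -
  have "(\<lambda>m. (defect m)\<^sup>2) = (\<lambda>(a, b, c, d). (real a * arctan_ratio a b + real c * arctan_ratio c d
      - real (a + c) * arctan_ratio (a + c) (b + d))\<^sup>2)"
    by auto
  then show ?thesis
    using infsumI[OF has_sum_defect_squared] by (simp only: unimodular_def)
qed

end
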